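(* Let $t$, $\delta$, and $s$ be positive integers and let $\varphi$ be a $\delta$-confined $\mathrm{CMSO}_1$-sentence with $s$ variables (that is, $|\mathrm{Var}(\varphi)|=s$). Let $\mathcal{M}$ be the class of hypergraphs that satisfy $\varphi$. If $C$ is a set with cardinality $t$, then the equivalence relation $\sim_{\mathcal{M},C}$ on $C$-coloured systems has at most $\Lambda_{\varphi}(s,t,\delta)$ equivalence classes.
   Context: **Hypergraphs and logic.** A hypergraph is a pair $(E,\mathcal{I})$ where $E$ is a finite set and $\mathcal{I}$ is a collection of subsets of $E$ (the hyperedges). Formulas of counting monadic second-order logic $\mathrm{CMSO}_1$ use variables from $\{Z_1,Z_2,\ldots\}$. The atomic formulas are $Z_i\subseteq Z_j$, $\mathsf{hyp}(Z_i)$, and $|Z_i|\equiv p \bmod q$ (with $p,q$ integers, $q>1$, $0\le p<q$); for an atomic formula, $\mathrm{Var}=\mathrm{Free}$ is the set of variables that occur in it. Formulas are: atomic formulas; $\neg\psi$ for a formula $\psi$ (with the same $\mathrm{Var}$ and $\mathrm{Free}$ as $\psi$); $\exists Z_s\psi$ where $\psi$ is a formula and $Z_s\in\mathrm{Free}(\psi)$ (with $\mathrm{Var}(\exists Z_s\psi)=\mathrm{Var}(\psi)$, $\mathrm{Free}(\exists Z_s\psi)=\mathrm{Free}(\psi)-\{Z_s\}$); and $\psi_1\land\psi_2$ where $(\mathrm{Var}(\psi_i)-\mathrm{Free}(\psi_i))\cap\mathrm{Free}(\psi_{3-i})=\emptyset$ for $i=1,2$ (with $\mathrm{Var}$ and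 $\mathrm{Free}$ the unions of those of $\psi_1,\psi_2$). A sentence is a formula $\varphi$ with $\mathrm{Free}(\varphi)=\emptyset$. A formula is $\delta$-confined if it uses no predicate $|\cdot|\equiv p\bmod q$ with $q>\delta$. An interpretation of $\varphi$ in $M=(E,\mathcal{I})$ is a function $\theta\colon\mathrm{Free}(\varphi)\to 2^E$; satisfaction by $(M,\theta)$ is defined in the usual way: $Z_i\subseteq Z_j$ holds if $\theta(Z_i)\subseteq\theta(Z_j)$, $\mathsf{hyp}(Z_i)$ holds if $\theta(Z_i)\in\mathcal{I}$, $|Z_i|\equiv p\bmod q$ holds if $|\theta(Z_i)|\equiv p\pmod q$, $\neg$ and $\land$ are as usual (restricting $\theta$ to the free variables of each conjunct), and $\exists Z_s\psi$ holds if $\psi$ is satisfied on extending $\theta$ by $Z_s\mapsto X$ for some $X\subseteq E$. **Coloured systems.** Let $C$ be a finite set. A $C$-coloured system is a pair $(U,c)$ where $U$ is a finite set and $c\colon 2^U\to C$ is a function. A $C$-coloured complement is a pair $(V,d)$ where $V$ is a finite set and $d\colon 2^V\times C\to\{0,1\}$ is a function. If $U\cap V=\emptyset$, the $C$-coloured sum $(U,c)\boxplus(V,d)$ is the hypergraph with ground set $U\cup V$ and set of hyperedges $\{X\cup Y: X\subseteq U,\ Y\subseteq V,\ d(Y,c(X))=1\}$. For a class $\mathcal{M}$ of hypergraphs, $(U_1,c_1)\sim_{\mathcal{M},C}(U_2,c_2)$ means that for every $C$-coloured complement $(V,d)$ with $V\cap U_1=V\cap U_2=\emptyset$, we have $(U_1,c_1)\boxplus(V,d)\in\mathcal{M}$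 if and only if $(U_2,c_2)\boxplus(V,d)\in\mathcal{M}$. **The bound.** For positive integers $s,t,\delta$ and a $\delta$-confined formula $\varphi$, the integer $\Lambda_\varphi(s,t,\delta)$ is defined recursively: it is $(\delta!)^s$ if $\varphi$ is $|Z_i|\equiv p\bmod q$; $t^s$ if $\varphi$ is $\mathsf{hyp}(Z_i)$; $2^{s^2}$ if $\varphi$ is $Z_i\subseteq Z_j$; $\Lambda_{\psi}(s,t,\delta)$ if $\varphi=\neg\psi$; $\Lambda_{\psi_1}(s,t,\delta)\Lambda_{\psi_2}(s,t,\delta)$ if $\varphi=\psi_1\land\psi_2$; and $2^{\Lambda_\psi(s,t,\delta)}$ if $\varphi=\exists Z_i\psi$. *)

theory Defs
  imports Main "HOL-Library.FuncSet" "HOL-Number_Theory.Cong"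
begin

type_synonym 'a hypergraph = "'a set \<times> 'a set set"

definition hypergraph :: "'a hypergraph \<Rightarrow> bool" where
  "hypergraph = (\<lambda>(E, \<I>). finite E \<and> \<I> \<subseteq> Pow E)"

text \<open>Raw syntax; the side conditions on formulas are imposed by \<open>formula\<close> below.
  The variable $Z_i$ is represented by its index, and \<open>CardMod i p q\<close> is
  $|Z_i| \equiv p \bmod q$.\<close>

datatype form =
    Sub nat nat
  | Hyp nat
  | CardMod nat nat nat
  | Neg form
  | Exi nat form
  | Conj form form

primrec Var :: "form \<Rightarrow> nat set" where
  "Var (Sub i j) = {i, j}"
| "Var (Hyp i) = {i}"
| "Var (CardMod i p q) = {i}"
| "Var (Neg \<psi>) = Var \<psi>"
| "Var (Exi s \<psi>) = Var \<psi>"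
| "Var (Conj \<psi>\<^sub>1 \<psi>\<^sub>2) = Var \<psi>\<^sub>1 \<union> Var \<psi>\<^sub>2"

primrec Free :: "form \<Rightarrow> nat set" where
  "Free (Sub i j) = {i, j}"
| "Free (Hyp i) = {i}"
| "Free (CardMod i p q) = {i}"
| "Free (Neg \<psi>) = Free \<psi>"
| "Free (Exi s \<psi>) = Free \<psi> - {s}"
| "Free (Conj \<psi>\<^sub>1 \<psi>\<^sub>2) = Free \<psi>\<^sub>1 \<union> Free \<psi>\<^sub>2"

primrec formula :: "form \<Rightarrow> bool" where
  "formula (Sub i j) \<longleftrightarrow> True"
| "formula (Hyp i) \<longleftrightarrow> True"
| "formula (CardMod i p q) \<longleftrightarrow> 1 < q \<and> p < q"
| "formula (Neg \<psi>) \<longleftrightarrow> formula \<psi>"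
| "formula (Exi s \<psi>) \<longleftrightarrow> formula \<psi> \<and> s \<in> Free \<psi>"
| "formula (Conj \<psi>\<^sub>1 \<psi>\<^sub>2) \<longleftrightarrow> formula \<psi>\<^sub>1 \<and> formula \<psi>\<^sub>2
     \<and> (Var \<psi>\<^sub>1 - Free \<psi>\<^sub>1) \<inter> Free \<psi>\<^sub>2 = {}
     \<and> (Var \<psi>\<^sub>2 - Free \<psi>\<^sub>2) \<inter> Free \<psi>\<^sub>1 = {}"

definition sentence :: "form \<Rightarrow> bool" where
  "sentence \<phi> \<longleftrightarrow> formula \<phi> \<and> Free \<phi> = {}"

primrec confined :: "nat \<Rightarrow> form \<Rightarrow> bool" where
  "confined \<delta> (Sub i j) \<longleftrightarrow> True"
| "confined \<delta> (Hyp i) \<longleftrightarrow> True"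
| "confined \<delta> (CardMod i p q) \<longleftrightarrow> q \<le> \<delta>"
| "confined \<delta> (Neg \<psi>) \<longleftrightarrow> confined \<delta> \<psi>"
| "confined \<delta> (Exi s \<psi>) \<longleftrightarrow> confined \<delta> \<psi>"
| "confined \<delta> (Conj \<psi>\<^sub>1 \<psi>\<^sub>2) \<longleftrightarrow> confined \<delta> \<psi>\<^sub>1 \<and> confined \<delta> \<psi>\<^sub>2"

text \<open>Interpretations are extensional functions, so that they correspond exactly to the
  functions $\mathrm{Free}(\varphi) \to 2^E$.\<close>

definition interpretations :: "form \<Rightarrow> 'a hypergraph \<Rightarrow> (nat \<Rightarrow> 'a set) set" where
  "interpretations \<phi> M = Free \<phi> \<rightarrow>\<^sub>E Pow (fst M)"

primrec sat :: "'a hypergraph \<Rightarrow> (nat \<Rightarrow> 'a set) \<Rightarrow> form \<Rightarrow> bool" where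
  "sat M \<theta> (Sub i j) \<longleftrightarrow> \<theta> i \<subseteq> \<theta> j"
| "sat M \<theta> (Hyp i) \<longleftrightarrow> \<theta> i \<in> snd M"
| "sat M \<theta> (CardMod i p q) \<longleftrightarrow> [card (\<theta> i) = p] (mod q)"
| "sat M \<theta> (Neg \<psi>) \<longleftrightarrow> \<not> sat M \<theta> \<psi>"
| "sat M \<theta> (Exi s \<psi>) \<longleftrightarrow> (\<exists>X \<subseteq> fst M. sat M (\<theta>(s := X)) \<psi>)"
| "sat M \<theta> (Conj \<psi>\<^sub>1 \<psi>\<^sub>2) \<longleftrightarrow>
     sat M (restrict \<theta> (Free \<psi>\<^sub>1)) \<psi>\<^sub>1 \<and> sat M (restrict \<theta> (Free \<psi>\<^sub>2)) \<psi>\<^sub>2"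

text \<open>For a sentence there is exactly one interpretation, the empty function.\<close>

definition models :: "form \<Rightarrow> 'a hypergraph set" where
  "models \<phi> = {M. hypergraph M \<and> (\<exists>\<theta> \<in> interpretations \<phi> M. sat M \<theta> \<phi>)}"

definition coloured_systems :: "'c set \<Rightarrow> ('a set \<times> ('a set \<Rightarrow> 'c)) set" where
  "coloured_systems C = {(U, c). finite U \<and> c \<in> Pow U \<rightarrow>\<^sub>E C}"

definition coloured_complements :: "'c set \<Rightarrow> ('a set \<times> ('a set \<times> 'c \<Rightarrow> nat)) set" where
  "coloured_complements C = {(V, d). finite V \<and> d \<in> Pow V \<times> C \<rightarrow>\<^sub>E {0, 1}}"

text \<open>Only meaningful when the two ground sets are disjoint.\<close>

definition coloured_sum ::
  "'a set \<times> ('a set \<Rightarrow> 'c) \<Rightarrow> 'a set \<times> ('a set \<times> 'c \<Rightarrow> nat) \<Rightarrow> 'a hypergraph"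
  (infixl "\<boxplus>" 65) where
  "S \<boxplus> T = (case (S, T) of ((U, c), (V, d)) \<Rightarrow>
     (U \<union> V, {X \<union> Y | X Y. X \<subseteq> U \<and> Y \<subseteq> V \<and> d (Y, c X) = 1}))"

text \<open>When the type \<open>'a\<close> is finite, the complements disjoint from a ground set may be
  exhausted and this relation can fail to be transitive; it stands in for the relation over
  all finite sets only when \<open>'a\<close> is infinite.\<close>

definition sim :: "'a hypergraph set \<Rightarrow> 'c set \<Rightarrow>
    ('a set \<times> ('a set \<Rightarrow> 'c)) rel" where
  "sim \<M> C = {((U\<^sub>1, c\<^sub>1), (U\<^sub>2, c\<^sub>2)).
     (U\<^sub>1, c\<^sub>1) \<in> coloured_systems C \<and> (U\<^sub>2, c\<^sub>2) \<in> coloured_systems C \<and>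
     (\<forall>(V, d) \<in> coloured_complements C. V \<inter> U\<^sub>1 = {} \<and> V \<inter> U\<^sub>2 = {} \<longrightarrow>
        ((U\<^sub>1, c\<^sub>1) \<boxplus> (V, d) \<in> \<M> \<longleftrightarrow> (U\<^sub>2, c\<^sub>2) \<boxplus> (V, d) \<in> \<M>))}"

primrec Lambda :: "form \<Rightarrow> nat \<Rightarrow> nat \<Rightarrow> nat \<Rightarrow> nat" where
  "Lambda (Sub i j) s t \<delta> = 2 ^ (s ^ 2)"
| "Lambda (Hyp i) s t \<delta> = t ^ s"
| "Lambda (CardMod i p q) s t \<delta> = fact \<delta> ^ s"
| "Lambda (Neg \<psi>) s t \<delta> = Lambda \<psi> s t \<delta>"
| "Lambda (Exi i \<psi>) s t \<delta> = 2 ^ Lambda \<psi> s t \<delta>"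
| "Lambda (Conj \<psi>\<^sub>1 \<psi>\<^sub>2) s t \<delta> = Lambda \<psi>\<^sub>1 s t \<delta> * Lambda \<psi>\<^sub>2 s t \<delta>"

end

theory Submission
  imports Defs "HOL-Library.Nat_Bijection"
begin

text \<open>To a coloured system \<open>(U, c)\<close> and an assignment of subsets of \<open>U\<close> to the variables we
  attach a type, by recursion on the formula: for an atomic formula it records what the
  \<open>U\<close>-part contributes to its truth value (whether the inclusion holds, the colour, or the
  residue), for a conjunction it is the pair of types of the conjuncts, and for
  \<open>\<exists>Z\<^sub>s \<psi>\<close> it is the set of all types that arise by choosing a subset of \<open>U\<close> for \<open>Z\<^sub>s\<close>.
  Types are coded as natural numbers below \<^const>\<open>Lambda\<close>. Systems with equal types satisfy
  the formula simultaneously whatever complement is added, even if the complement is renamed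
  along a bijection. The renaming gives transitivity of \<^const>\<open>sim\<close>: a complement that meets
  the middle system is first moved away from it.\<close>

section \<open>Types as natural numbers\<close>

text \<open>The parameter \<open>h\<close> numbers the colours, and \<open>L\<close> bounds the
  codes of each formula: the pair for a conjunction is written in radix
  \<open>L \<psi>\<^sub>2\<close>, a set of types in binary. Valuations are total, so no domain has
  to be tracked in the recursion.\<close>

primrec type_code ::
  "('c \<Rightarrow> nat) \<Rightarrow> (form \<Rightarrow> nat) \<Rightarrow> 'a set \<Rightarrow> ('a set \<Rightarrow> 'c) \<Rightarrow> (nat \<Rightarrow> 'a set) \<Rightarrow> form \<Rightarrow> nat"
where
  "type_code h L U c \<theta> (Sub i j) = of_bool (\<theta> i \<subseteq> \<theta> j)"
| "type_code h L U c \<theta> (Hyp i) = h (c (\<theta> i))"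
| "type_code h L U c \<theta> (CardMod i p q) = card (\<theta> i) mod q"
| "type_code h L U c \<theta> (Neg \<psi>) = type_code h L U c \<theta> \<psi>"
| "type_code h L U c \<theta> (Exi s \<psi>) =
     set_encode ((\<lambda>X. type_code h L U c (\<theta>(s := X)) \<psi>) ` Pow U)"
| "type_code h L U c \<theta> (Conj \<psi>\<^sub>1 \<psi>\<^sub>2) =
     type_code h L U c \<theta> \<psi>\<^sub>1 * L \<psi>\<^sub>2 + type_code h L U c \<theta> \<psi>\<^sub>2"

text \<open>The code of a set of numbers below \<open>n\<close> is a binary numeral with at most
  \<open>n\<close> digits.\<close>

lemma set_encode_less_power:
  assumes "A \<subseteq> {..<n}"
  shows "set_encode A < 2 ^ n"
proof -
  have "set_encode A \<le> (\<Sum>k<n. 2 ^ k)"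
    unfolding set_encode_def using assms by (intro sum_mono2) auto
  also have "\<dots> < 2 ^ n"
    by (induction n) auto
  finally show ?thesis .
qed

lemma mult_add_less_mult:
  fixes a b m n :: nat
  assumes "a < m" "b < n"
  shows "a * n + b < m * n"
proof -
  have "a * n + b < Suc a * n" using assms by simp
  also have "\<dots> \<le> m * n" using assms by (intro mult_le_mono1) simp
  finally show ?thesis .
qed

lemma mult_add_eq_iff:
  fixes a b a' b' n :: nat
  assumes "b < n" "b' < n"
  shows "a * n + b = a' * n + b' \<longleftrightarrow> a = a' \<and> b = b'"
proof
  assume eq: "a * n + b = a' * n + b'"
  have "(a * n + b) div n = a" "(a * n + b) mod n = b"
    "(a' * n + b') div n = a'" "(a' * n + b') mod n = b'"
    using assms by auto
  with eq show "a = a' \<and> b = b'" by metis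
qed simp

text \<open>At the atoms there are at most 2 truth values, \<open>t\<close> colours or \<delta>
  residues, and \<delta> \<le> \<delta>!; since \<open>s > 0\<close>, the exponents in
  \<open>Lambda\<close> only enlarge these bounds. The other cases mirror the recursion of
  \<open>Lambda\<close>: two digits for a conjunction, a set of codes for a quantifier.\<close>

lemma type_code_less_Lambda:
  assumes "formula \<phi>" "confined \<delta> \<phi>" "s > 0" "h \<in> C \<rightarrow> {..<t}" "c \<in> Pow U \<rightarrow> C"
    and "\<And>i. \<theta> i \<subseteq> U"
  shows "type_code h (\<lambda>\<psi>. Lambda \<psi> s t \<delta>) U c \<theta> \<phi> < Lambda \<phi> s t \<delta>"
  using assms(1,2,6)
proof (induction \<phi> arbitrary: \<theta>)
  case (Sub i j)
  have "(1 :: nat) < 2 ^ s\<^sup>2" using \<open>s > 0\<close> by (intro one_less_power) simp_all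
  then show ?case by (auto simp: of_bool_def)
next
  case (Hyp i)
  have "h (c (\<theta> i)) < t" using Hyp assms(4,5) by blast
  also have "\<dots> \<le> t ^ s" using calculation \<open>s > 0\<close> by (intro self_le_power) auto
  finally show ?case by simp
next
  case (CardMod i p q)
  have "card (\<theta> i) mod q < q" using CardMod by simp
  also have "\<dots> \<le> \<delta>" using CardMod by simp
  also have "\<dots> \<le> fact \<delta>" by (rule fact_ge_self)
  also have "\<dots> \<le> fact \<delta> ^ s" using \<open>s > 0\<close> by (intro self_le_power) auto
  finally show ?case by simp
next
  case (Exi r \<psi>)
  have "type_code h (\<lambda>\<psi>. Lambda \<psi> s t \<delta>) U c (\<theta>(r := X)) \<psi> < Lambda \<psi> s t \<delta>"
    if "X \<subseteq> U" for X
    using Exi that by simp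
  then show ?case by (auto intro: set_encode_less_power)
next
  case (Conj \<psi>\<^sub>1 \<psi>\<^sub>2)
  then show ?case by (simp add: mult_add_less_mult)
qed simp

section \<open>Satisfaction and free variables\<close>

lemma sat_cong:
  assumes "\<And>i. i \<in> Free \<phi> \<Longrightarrow> \<theta> i = \<theta>' i"
  shows "sat M \<theta> \<phi> \<longleftrightarrow> sat M \<theta>' \<phi>"
  using assms
proof (induction \<phi> arbitrary: \<theta> \<theta>')
  case (Exi r \<psi>)
  have "sat M (\<theta>(r := X)) \<psi> \<longleftrightarrow> sat M (\<theta>'(r := X)) \<psi>" for X
    using Exi.prems by (intro Exi.IH) auto
  then show ?case by simp
next
  case (Conj \<psi>\<^sub>1 \<psi>\<^sub>2)
  have "sat M (restrict \<theta> (Free \<psi>\<^sub>1)) \<psi>\<^sub>1 \<longleftrightarrow> sat M (restrict \<theta>' (Free \<psi>\<^sub>1)) \<psi>\<^sub>1"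
    using Conj.prems by (intro Conj.IH) auto
  moreover have "sat M (restrict \<theta> (Free \<psi>\<^sub>2)) \<psi>\<^sub>2 \<longleftrightarrow> sat M (restrict \<theta>' (Free \<psi>\<^sub>2)) \<psi>\<^sub>2"
    using Conj.prems by (intro Conj.IH) auto
  ultimately show ?case by simp
next
  case (Neg \<psi>)
  then show ?case by (metis Free.simps(4) sat.simps(4))
qed auto

text \<open>Each conjunct sees only its own free variables, so restricting to them changes nothing.
  This lets one total valuation serve both conjuncts in later inductions.\<close>

lemma sat_Conj_iff: "sat M \<theta> (Conj \<psi>\<^sub>1 \<psi>\<^sub>2) \<longleftrightarrow> sat M \<theta> \<psi>\<^sub>1 \<and> sat M \<theta> \<psi>\<^sub>2"
  using sat_cong[of \<psi>\<^sub>1 "restrict \<theta> (Free \<psi>\<^sub>1)" \<theta>] sat_cong[of \<psi>\<^sub>2 "restrict \<theta> (Free \<psi>\<^sub>2)" \<theta>]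
  by simp

text \<open>With no free variables every valuation gives the same truth value. The constant empty
  one is convenient because its values are subsets of every ground set.\<close>

lemma models_sentence_iff:
  assumes "sentence \<phi>"
  shows "M \<in> models \<phi> \<longleftrightarrow> hypergraph M \<and> sat M (\<lambda>_. {}) \<phi>"
proof -
  have "Free \<phi> = {}" using assms by (simp add: sentence_def)
  then have "sat M \<theta> \<phi> \<longleftrightarrow> sat M (\<lambda>_. {}) \<phi>" for \<theta> by (intro sat_cong) simp
  then show ?thesis
    using \<open>Free \<phi> = {}\<close> by (auto simp: models_def interpretations_def)
qed

section \<open>Subsets of a coloured sum\<close>

lemma hypergraph_coloured_sum:
  assumes "finite U" "finite V"
  shows "hypergraph ((U, c) \<boxplus> (V, d))"
  using assms by (auto simp: hypergraph_def coloured_sum_def)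

lemma fst_coloured_sum: "fst ((U, c) \<boxplus> (V, d)) = U \<union> V"
  by (simp add: coloured_sum_def)

text \<open>Disjointness of the ground sets makes the splitting of a set into its two parts unique,
  so no other pair can witness membership.\<close>

lemma hyperedge_coloured_sum_iff:
  assumes "U \<inter> V = {}" "X \<subseteq> U" "Y \<subseteq> V"
  shows "X \<union> Y \<in> snd ((U, c) \<boxplus> (V, d)) \<longleftrightarrow> d (Y, c X) = 1"
proof -
  have "X' = X \<and> Y' = Y" if "X \<union> Y = X' \<union> Y'" "X' \<subseteq> U" "Y' \<subseteq> V" for X' Y'
    using that assms by blast
  then show ?thesis
    using assms unfolding coloured_sum_def by auto
qed

text \<open>Separates a quantifier over the ground set of a sum into a choice in the system and a
  choice in the complement.\<close>

lemma ex_subset_Un_iff: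
  "(\<exists>Z \<subseteq> A \<union> B. P Z) \<longleftrightarrow> (\<exists>X \<subseteq> A. \<exists>Y \<subseteq> B. P (X \<union> Y))"
  by (metis Un_mono subset_UnE)

lemma ex_subset_image_iff: "(\<exists>Y \<subseteq> f ` A. P Y) \<longleftrightarrow> (\<exists>X \<subseteq> A. P (f ` X))"
  by (auto simp: subset_image_iff)

lemma Un_subset_Un_iff_disjoint:
  assumes "U \<inter> V = {}" "X \<subseteq> U" "X' \<subseteq> U" "Y \<subseteq> V" "Y' \<subseteq> V"
  shows "X \<union> Y \<subseteq> X' \<union> Y' \<longleftrightarrow> X \<subseteq> X' \<and> Y \<subseteq> Y'"
  using assms by blast

section \<open>Equal types give equal truth values\<close>

text \<open>A back-and-forth argument by induction on the formula: a choice in one system is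
  answered by a choice of the same type in the other, while the choice in the complement is copied
  along \<open>g\<close>. All three valuations are generalised because a quantifier updates each of
  them.\<close>

lemma sat_coloured_sum_type_code_cong:
  assumes "formula \<phi>" "confined \<delta> \<phi>" "s > 0"
    and h: "h \<in> C \<rightarrow> {..<t}" "inj_on h C"
    and c: "c\<^sub>1 \<in> Pow U\<^sub>1 \<rightarrow> C" "c\<^sub>2 \<in> Pow U\<^sub>2 \<rightarrow> C"
    and fin: "finite U\<^sub>1" "finite U\<^sub>2" "finite V\<^sub>1"
    and disj: "U\<^sub>1 \<inter> V\<^sub>1 = {}" "U\<^sub>2 \<inter> V\<^sub>2 = {}"
    and g: "bij_betw g V\<^sub>1 V\<^sub>2"
    and d: "\<And>Y k. Y \<subseteq> V\<^sub>1 \<Longrightarrow> k \<in> C \<Longrightarrow> d\<^sub>2 (g ` Y, k) = d\<^sub>1 (Y, k)"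
    and "\<And>i. \<theta>\<^sub>1 i \<subseteq> U\<^sub>1" "\<And>i. \<theta>\<^sub>2 i \<subseteq> U\<^sub>2" "\<And>i. \<eta> i \<subseteq> V\<^sub>1"
    and "type_code h (\<lambda>\<psi>. Lambda \<psi> s t \<delta>) U\<^sub>1 c\<^sub>1 \<theta>\<^sub>1 \<phi> =
         type_code h (\<lambda>\<psi>. Lambda \<psi> s t \<delta>) U\<^sub>2 c\<^sub>2 \<theta>\<^sub>2 \<phi>"
  shows "sat ((U\<^sub>1, c\<^sub>1) \<boxplus> (V\<^sub>1, d\<^sub>1)) (\<lambda>i. \<theta>\<^sub>1 i \<union> \<eta> i) \<phi> \<longleftrightarrow>
         sat ((U\<^sub>2, c\<^sub>2) \<boxplus> (V\<^sub>2, d\<^sub>2)) (\<lambda>i. \<theta>\<^sub>2 i \<union> g ` \<eta> i) \<phi>"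
  using assms(1,2,15-)
proof (induction \<phi> arbitrary: \<theta>\<^sub>1 \<theta>\<^sub>2 \<eta>)
  case (Sub i j)
  have inj: "inj_on g V\<^sub>1" and V\<^sub>2: "V\<^sub>2 = g ` V\<^sub>1" using g by (auto simp: bij_betw_def)
  have sub: "\<theta>\<^sub>1 k \<subseteq> U\<^sub>1" "\<theta>\<^sub>2 k \<subseteq> U\<^sub>2" "\<eta> k \<subseteq> V\<^sub>1" "g ` \<eta> k \<subseteq> V\<^sub>2" for k
    using Sub V\<^sub>2 by (simp_all add: image_mono)
  have "\<theta>\<^sub>1 i \<union> \<eta> i \<subseteq> \<theta>\<^sub>1 j \<union> \<eta> j \<longleftrightarrow> \<theta>\<^sub>1 i \<subseteq> \<theta>\<^sub>1 j \<and> \<eta> i \<subseteq> \<eta> j"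
    using sub disj by (intro Un_subset_Un_iff_disjoint)
  moreover have "\<theta>\<^sub>2 i \<union> g ` \<eta> i \<subseteq> \<theta>\<^sub>2 j \<union> g ` \<eta> j \<longleftrightarrow> \<theta>\<^sub>2 i \<subseteq> \<theta>\<^sub>2 j \<and> g ` \<eta> i \<subseteq> g ` \<eta> j"
    using sub disj by (intro Un_subset_Un_iff_disjoint)
  \<comment> \<open>Inclusion is expressed as an equation between a union and one of its members, to
    which injectivity of \<open>g\<close> on subsets of \<open>V\<^sub>1\<close> applies.\<close>
  moreover have "g ` \<eta> i \<subseteq> g ` \<eta> j \<longleftrightarrow> \<eta> i \<subseteq> \<eta> j"
    unfolding subset_Un_eq image_Un[symmetric]
    by (intro inj_on_image_eq_iff[OF inj] Un_least sub)
  ultimately show ?case using Sub.prems(6) by (simp add: of_bool_def split: if_splits)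
next
  case (Hyp i)
  have V\<^sub>2: "V\<^sub>2 = g ` V\<^sub>1" using g by (auto simp: bij_betw_def)
  have sub: "\<theta>\<^sub>1 i \<subseteq> U\<^sub>1" "\<theta>\<^sub>2 i \<subseteq> U\<^sub>2" "\<eta> i \<subseteq> V\<^sub>1" "g ` \<eta> i \<subseteq> V\<^sub>2"
    using Hyp V\<^sub>2 by (simp_all add: image_mono)
  then have cC: "c\<^sub>1 (\<theta>\<^sub>1 i) \<in> C" "c\<^sub>2 (\<theta>\<^sub>2 i) \<in> C" using c by blast+
  with Hyp.prems h have "c\<^sub>1 (\<theta>\<^sub>1 i) = c\<^sub>2 (\<theta>\<^sub>2 i)" by (simp add: inj_on_eq_iff)
  moreover have "\<theta>\<^sub>1 i \<union> \<eta> i \<in> snd ((U\<^sub>1, c\<^sub>1) \<boxplus> (V\<^sub>1, d\<^sub>1)) \<longleftrightarrow> d\<^sub>1 (\<eta> i, c\<^sub>1 (\<theta>\<^sub>1 i)) = 1"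
    using sub disj by (intro hyperedge_coloured_sum_iff)
  moreover have "\<theta>\<^sub>2 i \<union> g ` \<eta> i \<in> snd ((U\<^sub>2, c\<^sub>2) \<boxplus> (V\<^sub>2, d\<^sub>2)) \<longleftrightarrow>
      d\<^sub>2 (g ` \<eta> i, c\<^sub>2 (\<theta>\<^sub>2 i)) = 1"
    using sub disj by (intro hyperedge_coloured_sum_iff)
  ultimately show ?case using d[of "\<eta> i"] sub cC by simp
next
  case (CardMod i p q)
  have inj: "inj_on g V\<^sub>1" and V\<^sub>2: "V\<^sub>2 = g ` V\<^sub>1" using g by (auto simp: bij_betw_def)
  have sub: "\<theta>\<^sub>1 i \<subseteq> U\<^sub>1" "\<theta>\<^sub>2 i \<subseteq> U\<^sub>2" "\<eta> i \<subseteq> V\<^sub>1" "g ` \<eta> i \<subseteq> V\<^sub>2"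
    using CardMod V\<^sub>2 by (simp_all add: image_mono)
  then have fins: "finite (\<theta>\<^sub>1 i)" "finite (\<theta>\<^sub>2 i)" "finite (\<eta> i)"
    using fin finite_subset by blast+
  have "\<theta>\<^sub>1 i \<inter> \<eta> i = {}" "\<theta>\<^sub>2 i \<inter> g ` \<eta> i = {}" using sub disj by blast+
  note card_Un = card_Un_disjoint[OF fins(1,3) this(1)]
    card_Un_disjoint[OF fins(2) finite_imageI[OF fins(3)] this(2)]
  have "card (g ` \<eta> i) = card (\<eta> i)"
    using inj sub by (meson card_image inj_on_subset)
  moreover have "card (\<theta>\<^sub>1 i) mod q = card (\<theta>\<^sub>2 i) mod q" using CardMod.prems(6) by simp
  \<comment> \<open>Cardinalities add over the disjoint parts; the system parts agree modulo
    \<open>q\<close> and the complement parts have equal size.\<close>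
  ultimately show ?case by (simp add: card_Un cong_def) (metis mod_add_left_eq)
next
  case (Neg \<psi>)
  then show ?case by simp
next
  case (Exi r \<psi>)
  let ?tp = "\<lambda>U c \<theta>. type_code h (\<lambda>\<psi>. Lambda \<psi> s t \<delta>) U c \<theta> \<psi>"
  have V\<^sub>2: "V\<^sub>2 = g ` V\<^sub>1" using g by (auto simp: bij_betw_def)
  \<comment> \<open>\<open>set_encode\<close> is injective on finite sets, and a finite ground set
    has only finitely many subsets to produce types.\<close>
  have types: "(\<lambda>X. ?tp U\<^sub>1 c\<^sub>1 (\<theta>\<^sub>1(r := X))) ` Pow U\<^sub>1 = (\<lambda>X. ?tp U\<^sub>2 c\<^sub>2 (\<theta>\<^sub>2(r := X))) ` Pow U\<^sub>2"
    using Exi.prems(6) fin by (simp add: set_encode_eq)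
  have IH: "sat ((U\<^sub>1, c\<^sub>1) \<boxplus> (V\<^sub>1, d\<^sub>1)) ((\<lambda>i. \<theta>\<^sub>1 i \<union> \<eta> i)(r := X\<^sub>1 \<union> Y)) \<psi> \<longleftrightarrow>
      sat ((U\<^sub>2, c\<^sub>2) \<boxplus> (V\<^sub>2, d\<^sub>2)) ((\<lambda>i. \<theta>\<^sub>2 i \<union> g ` \<eta> i)(r := X\<^sub>2 \<union> g ` Y)) \<psi>"
    if "X\<^sub>1 \<subseteq> U\<^sub>1" "X\<^sub>2 \<subseteq> U\<^sub>2" "Y \<subseteq> V\<^sub>1"
      and "?tp U\<^sub>1 c\<^sub>1 (\<theta>\<^sub>1(r := X\<^sub>1)) = ?tp U\<^sub>2 c\<^sub>2 (\<theta>\<^sub>2(r := X\<^sub>2))" for X\<^sub>1 X\<^sub>2 Y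
  proof -
    have upd:
      "(\<lambda>i. \<theta>\<^sub>1 i \<union> \<eta> i)(r := X\<^sub>1 \<union> Y) =
       (\<lambda>i. (\<theta>\<^sub>1(r := X\<^sub>1)) i \<union> (\<eta>(r := Y)) i)"
      "(\<lambda>i. \<theta>\<^sub>2 i \<union> g ` \<eta> i)(r := X\<^sub>2 \<union> g ` Y) =
       (\<lambda>i. (\<theta>\<^sub>2(r := X\<^sub>2)) i \<union> g ` (\<eta>(r := Y)) i)"
      by (simp_all add: fun_eq_iff)
    show ?thesis
      unfolding upd
      by (rule Exi.IH[of "\<theta>\<^sub>1(r := X\<^sub>1)" "\<theta>\<^sub>2(r := X\<^sub>2)" "\<eta>(r := Y)"])
        (use Exi.prems that in \<open>simp_all add: fun_upd_def\<close>)
  qed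
  have "sat ((U\<^sub>1, c\<^sub>1) \<boxplus> (V\<^sub>1, d\<^sub>1)) (\<lambda>i. \<theta>\<^sub>1 i \<union> \<eta> i) (Exi r \<psi>) \<longleftrightarrow>
      (\<exists>X \<subseteq> U\<^sub>1. \<exists>Y \<subseteq> V\<^sub>1.
        sat ((U\<^sub>1, c\<^sub>1) \<boxplus> (V\<^sub>1, d\<^sub>1)) ((\<lambda>i. \<theta>\<^sub>1 i \<union> \<eta> i)(r := X \<union> Y)) \<psi>)"
    unfolding sat.simps fst_coloured_sum ex_subset_Un_iff ..
  also have "\<dots> \<longleftrightarrow> (\<exists>X \<subseteq> U\<^sub>2. \<exists>Y \<subseteq> V\<^sub>1.
        sat ((U\<^sub>2, c\<^sub>2) \<boxplus> (V\<^sub>2, d\<^sub>2)) ((\<lambda>i. \<theta>\<^sub>2 i \<union> g ` \<eta> i)(r := X \<union> g ` Y)) \<psi>)"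
  proof (intro iffI; elim exE conjE)
    fix X Y
    assume X: "X \<subseteq> U\<^sub>1" "Y \<subseteq> V\<^sub>1"
      "sat ((U\<^sub>1, c\<^sub>1) \<boxplus> (V\<^sub>1, d\<^sub>1)) ((\<lambda>i. \<theta>\<^sub>1 i \<union> \<eta> i)(r := X \<union> Y)) \<psi>"
    \<comment> \<open>The type of \<open>X\<close> occurs among the types on the other side; a set
      \<open>X'\<close> realising it there is the answer to \<open>X\<close>, with \<open>Y\<close>
      kept.\<close>
    have "?tp U\<^sub>1 c\<^sub>1 (\<theta>\<^sub>1(r := X)) \<in> (\<lambda>X. ?tp U\<^sub>2 c\<^sub>2 (\<theta>\<^sub>2(r := X))) ` Pow U\<^sub>2"
      unfolding types[symmetric] using X(1) by (intro imageI PowI)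
    then obtain X' where X': "X' \<subseteq> U\<^sub>2"
      "?tp U\<^sub>1 c\<^sub>1 (\<theta>\<^sub>1(r := X)) = ?tp U\<^sub>2 c\<^sub>2 (\<theta>\<^sub>2(r := X'))"
      by (elim imageE) (rule that, erule PowD, assumption)
    have "sat ((U\<^sub>2, c\<^sub>2) \<boxplus> (V\<^sub>2, d\<^sub>2)) ((\<lambda>i. \<theta>\<^sub>2 i \<union> g ` \<eta> i)(r := X' \<union> g ` Y)) \<psi>"
      using IH[OF X(1) X'(1) X(2) X'(2)] X(3) by (rule iffD1)
    with X' X show "\<exists>X \<subseteq> U\<^sub>2. \<exists>Y \<subseteq> V\<^sub>1.
        sat ((U\<^sub>2, c\<^sub>2) \<boxplus> (V\<^sub>2, d\<^sub>2)) ((\<lambda>i. \<theta>\<^sub>2 i \<union> g ` \<eta> i)(r := X \<union> g ` Y)) \<psi>"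
      by (intro exI conjI)
  next
    fix X Y
    assume X: "X \<subseteq> U\<^sub>2" "Y \<subseteq> V\<^sub>1"
      "sat ((U\<^sub>2, c\<^sub>2) \<boxplus> (V\<^sub>2, d\<^sub>2)) ((\<lambda>i. \<theta>\<^sub>2 i \<union> g ` \<eta> i)(r := X \<union> g ` Y)) \<psi>"
    have "?tp U\<^sub>2 c\<^sub>2 (\<theta>\<^sub>2(r := X)) \<in> (\<lambda>X. ?tp U\<^sub>1 c\<^sub>1 (\<theta>\<^sub>1(r := X))) ` Pow U\<^sub>1"
      unfolding types using X(1) by (intro imageI PowI)
    then obtain X' where X': "X' \<subseteq> U\<^sub>1"
      "?tp U\<^sub>2 c\<^sub>2 (\<theta>\<^sub>2(r := X)) = ?tp U\<^sub>1 c\<^sub>1 (\<theta>\<^sub>1(r := X'))"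
      by (elim imageE) (rule that, erule PowD, assumption)
    have "sat ((U\<^sub>1, c\<^sub>1) \<boxplus> (V\<^sub>1, d\<^sub>1)) ((\<lambda>i. \<theta>\<^sub>1 i \<union> \<eta> i)(r := X' \<union> Y)) \<psi>"
      using IH[OF X'(1) X(1) X(2) X'(2)[symmetric]] X(3) by (rule iffD2)
    with X' X show "\<exists>X \<subseteq> U\<^sub>1. \<exists>Y \<subseteq> V\<^sub>1.
        sat ((U\<^sub>1, c\<^sub>1) \<boxplus> (V\<^sub>1, d\<^sub>1)) ((\<lambda>i. \<theta>\<^sub>1 i \<union> \<eta> i)(r := X \<union> Y)) \<psi>"
      by (intro exI conjI)
  qed
  also have "\<dots> \<longleftrightarrow> sat ((U\<^sub>2, c\<^sub>2) \<boxplus> (V\<^sub>2, d\<^sub>2)) (\<lambda>i. \<theta>\<^sub>2 i \<union> g ` \<eta> i) (Exi r \<psi>)"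
    unfolding sat.simps fst_coloured_sum ex_subset_Un_iff V\<^sub>2 ex_subset_image_iff ..
  finally show ?case .
next
  case (Conj \<psi>\<^sub>1 \<psi>\<^sub>2)
  \<comment> \<open>The second digits lie below the radix, so equal codes of pairs have equal
    components.\<close>
  have "type_code h (\<lambda>\<psi>. Lambda \<psi> s t \<delta>) U\<^sub>1 c\<^sub>1 \<theta>\<^sub>1 \<psi>\<^sub>2 < Lambda \<psi>\<^sub>2 s t \<delta>"
    "type_code h (\<lambda>\<psi>. Lambda \<psi> s t \<delta>) U\<^sub>2 c\<^sub>2 \<theta>\<^sub>2 \<psi>\<^sub>2 < Lambda \<psi>\<^sub>2 s t \<delta>"
    using Conj.prems by (simp_all add: type_code_less_Lambda[OF _ _ assms(3) h(1)] c)
  note eq = Conj.prems(6)[unfolded type_code.simps mult_add_eq_iff[OF this]]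
  have "sat ((U\<^sub>1, c\<^sub>1) \<boxplus> (V\<^sub>1, d\<^sub>1)) (\<lambda>i. \<theta>\<^sub>1 i \<union> \<eta> i) \<psi>\<^sub>1 \<longleftrightarrow>
      sat ((U\<^sub>2, c\<^sub>2) \<boxplus> (V\<^sub>2, d\<^sub>2)) (\<lambda>i. \<theta>\<^sub>2 i \<union> g ` \<eta> i) \<psi>\<^sub>1"
    using Conj.prems eq by (intro Conj.IH(1)) simp_all
  moreover have "sat ((U\<^sub>1, c\<^sub>1) \<boxplus> (V\<^sub>1, d\<^sub>1)) (\<lambda>i. \<theta>\<^sub>1 i \<union> \<eta> i) \<psi>\<^sub>2 \<longleftrightarrow>
      sat ((U\<^sub>2, c\<^sub>2) \<boxplus> (V\<^sub>2, d\<^sub>2)) (\<lambda>i. \<theta>\<^sub>2 i \<union> g ` \<eta> i) \<psi>\<^sub>2"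
    using Conj.prems eq by (intro Conj.IH(2)) simp_all
  ultimately show ?case
    unfolding sat_Conj_iff by simp
qed

lemma models_coloured_sum_cong:
  assumes "sentence \<phi>" "confined \<delta> \<phi>" "s > 0" "h \<in> C \<rightarrow> {..<t}" "inj_on h C"
    and "(U\<^sub>1, c\<^sub>1) \<in> coloured_systems C" "(U\<^sub>2, c\<^sub>2) \<in> coloured_systems C"
    and "finite V\<^sub>1" "U\<^sub>1 \<inter> V\<^sub>1 = {}" "U\<^sub>2 \<inter> V\<^sub>2 = {}" "bij_betw g V\<^sub>1 V\<^sub>2"
    and "\<And>Y k. Y \<subseteq> V\<^sub>1 \<Longrightarrow> k \<in> C \<Longrightarrow> d\<^sub>2 (g ` Y, k) = d\<^sub>1 (Y, k)"
    and "type_code h (\<lambda>\<psi>. Lambda \<psi> s t \<delta>) U\<^sub>1 c\<^sub>1 (\<lambda>_. {}) \<phi> =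
         type_code h (\<lambda>\<psi>. Lambda \<psi> s t \<delta>) U\<^sub>2 c\<^sub>2 (\<lambda>_. {}) \<phi>"
  shows "(U\<^sub>1, c\<^sub>1) \<boxplus> (V\<^sub>1, d\<^sub>1) \<in> models \<phi> \<longleftrightarrow> (U\<^sub>2, c\<^sub>2) \<boxplus> (V\<^sub>2, d\<^sub>2) \<in> models \<phi>"
proof -
  have U: "finite U\<^sub>1" "finite U\<^sub>2" "c\<^sub>1 \<in> Pow U\<^sub>1 \<rightarrow> C" "c\<^sub>2 \<in> Pow U\<^sub>2 \<rightarrow> C"
    using assms(6,7) by (auto simp: coloured_systems_def PiE_def)
  have "finite V\<^sub>2" using assms(8,11) bij_betw_finite by blast
  have "formula \<phi>" using assms(1) by (simp add: sentence_def)
  \<comment> \<open>The unions of empty sets give the empty valuation the split form required by the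
    induction.\<close>
  have "sat ((U\<^sub>1, c\<^sub>1) \<boxplus> (V\<^sub>1, d\<^sub>1)) (\<lambda>i. {} \<union> {}) \<phi> \<longleftrightarrow>
      sat ((U\<^sub>2, c\<^sub>2) \<boxplus> (V\<^sub>2, d\<^sub>2)) (\<lambda>i. {} \<union> g ` {}) \<phi>"
    by (rule sat_coloured_sum_type_code_cong[where \<theta>\<^sub>1 = "\<lambda>_. {}" and \<theta>\<^sub>2 = "\<lambda>_. {}"
          and \<eta> = "\<lambda>_. {}"])
      (use assms U \<open>formula \<phi>\<close> in auto)
  then show ?thesis
    using assms(1,8) U \<open>finite V\<^sub>2\<close> by (simp add: models_sentence_iff hypergraph_coloured_sum)
qed

section \<open>Renaming complements\<close>

text \<open>An infinite type leaves room outside the finite set \<open>W\<close> for a copy of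
  \<open>V\<close>; \<open>d\<close> is carried over through the inverse bijection.\<close>

lemma coloured_complement_rename:
  fixes V W :: "'a set"
  assumes "infinite (UNIV :: 'a set)" "(V, d) \<in> coloured_complements C" "finite W"
  obtains V' d' g where "(V', d') \<in> coloured_complements C" "V' \<inter> W = {}" "bij_betw g V V'"
    "\<And>Y k. Y \<subseteq> V \<Longrightarrow> k \<in> C \<Longrightarrow> d' (g ` Y, k) = d (Y, k)"
proof -
  have V: "finite V" "d \<in> Pow V \<times> C \<rightarrow> {0, 1}"
    using assms(2) by (auto simp: coloured_complements_def PiE_def)
  have "infinite (- W)" using assms by (simp add: Compl_eq_Diff_UNIV)
  then obtain V' where V': "V' \<subseteq> - W" "finite V'" "card V' = card V"
    using infinite_arbitrarily_large by metis
  then obtain g where g: "bij_betw g V V'"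
    using V finite_same_card_bij by metis
  \<comment> \<open>The restriction makes \<open>d'\<close> extensional, as membership in
    \<open>coloured_complements\<close> demands.\<close>
  define d' where "d' = restrict (\<lambda>(Y, k). d (inv_into V g ` Y, k)) (Pow V' \<times> C)"
  have "inv_into V g ` Y \<subseteq> V" if "Y \<subseteq> V'" for Y
    using bij_betw_inv_into[OF g] that by (auto simp: bij_betw_def)
  then have "d (inv_into V g ` Y, k) \<in> {0, 1}" if "Y \<subseteq> V'" "k \<in> C" for Y k
    using that by (intro funcset_mem[OF V(2)]) simp
  then have "d' \<in> Pow V' \<times> C \<rightarrow>\<^sub>E {0, 1}"
    by (intro PiE_I) (auto simp: d'_def)
  then have "(V', d') \<in> coloured_complements C"
    using V' by (simp add: coloured_complements_def)
  moreover have "d' (g ` Y, k) = d (Y, k)" if "Y \<subseteq> V" "k \<in> C" for Y k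
  proof -
    have "inv_into V g ` g ` Y = Y" "g ` Y \<subseteq> V'"
      using g that by (auto simp: bij_betw_def inv_into_image_cancel)
    then show ?thesis using that by (simp add: d'_def)
  qed
  ultimately show thesis using that V' g by blast
qed

section \<open>Equivalence and the number of classes\<close>

lemma simI:
  assumes "(U\<^sub>1, c\<^sub>1) \<in> coloured_systems C" "(U\<^sub>2, c\<^sub>2) \<in> coloured_systems C"
    and "\<And>V d. (V, d) \<in> coloured_complements C \<Longrightarrow> V \<inter> U\<^sub>1 = {} \<Longrightarrow> V \<inter> U\<^sub>2 = {} \<Longrightarrow>
      (U\<^sub>1, c\<^sub>1) \<boxplus> (V, d) \<in> \<M> \<longleftrightarrow> (U\<^sub>2, c\<^sub>2) \<boxplus> (V, d) \<in> \<M>"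
  shows "((U\<^sub>1, c\<^sub>1), (U\<^sub>2, c\<^sub>2)) \<in> sim \<M> C"
  using assms by (auto simp: sim_def)

lemma simD:
  assumes "((U\<^sub>1, c\<^sub>1), (U\<^sub>2, c\<^sub>2)) \<in> sim \<M> C"
    and "(V, d) \<in> coloured_complements C" "V \<inter> U\<^sub>1 = {}" "V \<inter> U\<^sub>2 = {}"
  shows "(U\<^sub>1, c\<^sub>1) \<boxplus> (V, d) \<in> \<M> \<longleftrightarrow> (U\<^sub>2, c\<^sub>2) \<boxplus> (V, d) \<in> \<M>"
  using assms unfolding sim_def by blast

text \<open>A class is determined by the value of \<open>f\<close> on it, so choosing a
  representative for each value below \<open>n\<close> reaches all classes. Values that
  \<open>f\<close> does not take yield arbitrary sets, harmless for an upper bound.\<close>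

lemma card_quotient_le:
  fixes f :: "'a \<Rightarrow> nat"
  assumes "equiv A R" "\<And>x. x \<in> A \<Longrightarrow> f x < n"
    and "\<And>x y. x \<in> A \<Longrightarrow> y \<in> A \<Longrightarrow> f x = f y \<Longrightarrow> (x, y) \<in> R"
  shows "finite (A // R) \<and> card (A // R) \<le> n"
proof -
  let ?g = "\<lambda>k. R `` {SOME x. x \<in> A \<and> f x = k}"
  have "R `` {x} = ?g (f x)" if "x \<in> A" for x
  proof (intro equiv_class_eq[OF assms(1)] assms(3) that)
    let ?y = "SOME y. y \<in> A \<and> f y = f x"
    have "?y \<in> A \<and> f ?y = f x" by (rule someI[of _ x]) (use that in simp)
    then show "?y \<in> A" "f x = f ?y" by simp_all
  qed
  then have sub: "A // R \<subseteq> ?g ` {..<n}"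
    using assms(2) by (auto elim!: quotientE)
  show ?thesis
    using surj_card_le[OF finite_lessThan sub] finite_subset[OF sub] by simp
qed

theorem lemma3p7:
  fixes t \<delta> s :: nat and \<phi> :: form and C :: "'c set"
    and \<M> :: "'a hypergraph set" and S :: "('a set \<times> ('a set \<Rightarrow> 'c)) set"
  assumes "infinite (UNIV :: 'a set)"
    and "t > 0" and "\<delta> > 0" and "s > 0"
    and "sentence \<phi>" and "confined \<delta> \<phi>" and "card (Var \<phi>) = s"
    and "\<M> = models \<phi>"
    and "finite C" and "card C = t"
    and "S = coloured_systems C"
  shows "equiv S (sim \<M> C) \<and> finite (S // sim \<M> C) \<and> card (S // sim \<M> C) \<le> Lambda \<phi> s t \<delta>"
proof -
  obtain h where "bij_betw h C {..<t}"
    using assms(9,10) ex_bij_betw_finite_nat atLeast0LessThan by metis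
  then have h: "h \<in> C \<rightarrow> {..<t}" "inj_on h C"
    by (auto simp: bij_betw_def)
  note cong = models_coloured_sum_cong[OF assms(5,6,4) h]
  define f where
    "f = (\<lambda>(U :: 'a set, c). type_code h (\<lambda>\<psi>. Lambda \<psi> s t \<delta>) U c (\<lambda>_. {}) \<phi>)"
  have eqv: "equiv S (sim \<M> C)"
  proof (rule equivI)
    show "sim \<M> C \<subseteq> S \<times> S" using assms(11) by (auto simp: sim_def)
    show "refl_on S (sim \<M> C)" using assms(11) by (auto simp: sim_def refl_on_def)
    show "sym (sim \<M> C)" by (auto simp: sim_def sym_def)
    show "trans (sim \<M> C)"
    proof (rule transI, safe)
      fix U\<^sub>1 U\<^sub>2 U\<^sub>3 :: "'a set" and c\<^sub>1 c\<^sub>2 c\<^sub>3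
      assume 12: "((U\<^sub>1, c\<^sub>1), (U\<^sub>2, c\<^sub>2)) \<in> sim \<M> C" and 23: "((U\<^sub>2, c\<^sub>2), (U\<^sub>3, c\<^sub>3)) \<in> sim \<M> C"
      then have sys: "(U\<^sub>1, c\<^sub>1) \<in> coloured_systems C" "(U\<^sub>2, c\<^sub>2) \<in> coloured_systems C"
        "(U\<^sub>3, c\<^sub>3) \<in> coloured_systems C" by (auto simp: sim_def)
      then have fin: "finite (U\<^sub>1 \<union> U\<^sub>2 \<union> U\<^sub>3)" by (auto simp: coloured_systems_def)
      show "((U\<^sub>1, c\<^sub>1), (U\<^sub>3, c\<^sub>3)) \<in> sim \<M> C"
      proof (rule simI[OF sys(1,3)])
        fix V d
        assume V: "(V, d) \<in> coloured_complements C" "V \<inter> U\<^sub>1 = {}" "V \<inter> U\<^sub>3 = {}"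
        then have "finite V" by (auto simp: coloured_complements_def)
        \<comment> \<open>\<open>V\<close> may meet the middle ground set \<open>U\<^sub>2\<close>.
          The copy avoids all three ground sets, so both given relations apply to it.\<close>
        obtain V' d' g where V': "(V', d') \<in> coloured_complements C" "V' \<inter> (U\<^sub>1 \<union> U\<^sub>2 \<union> U\<^sub>3) = {}"
          and g: "bij_betw g V V'"
          and d': "\<And>Y k. Y \<subseteq> V \<Longrightarrow> k \<in> C \<Longrightarrow> d' (g ` Y, k) = d (Y, k)"
          using coloured_complement_rename[OF assms(1) V(1) fin] by metis
        \<comment> \<open>Here the system is the same on both sides, so the types agree trivially
          and only the complement is renamed.\<close>
        have "(U\<^sub>1, c\<^sub>1) \<boxplus> (V, d) \<in> \<M> \<longleftrightarrow> (U\<^sub>1, c\<^sub>1) \<boxplus> (V', d') \<in> \<M>"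
          unfolding assms(8)
          by (rule cong[OF sys(1,1) \<open>finite V\<close>, where g = g]) (use V V' g d' in auto)
        also have "\<dots> \<longleftrightarrow> (U\<^sub>2, c\<^sub>2) \<boxplus> (V', d') \<in> \<M>"
          using simD[OF 12 V'(1)] V' by blast
        also have "\<dots> \<longleftrightarrow> (U\<^sub>3, c\<^sub>3) \<boxplus> (V', d') \<in> \<M>"
          using simD[OF 23 V'(1)] V' by blast
        also have "\<dots> \<longleftrightarrow> (U\<^sub>3, c\<^sub>3) \<boxplus> (V, d) \<in> \<M>"
          unfolding assms(8)
          by (rule cong[OF sys(3,3) \<open>finite V\<close>, where g = g, symmetric]) (use V V' g d' in auto)
        finally show "(U\<^sub>1, c\<^sub>1) \<boxplus> (V, d) \<in> \<M> \<longleftrightarrow> (U\<^sub>3, c\<^sub>3) \<boxplus> (V, d) \<in> \<M>" .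
      qed
    qed
  qed
  moreover have "f x < Lambda \<phi> s t \<delta>" if "x \<in> S" for x
  proof (cases x)
    case (Pair U c)
    with that have "c \<in> Pow U \<rightarrow> C"
      using assms(11) by (auto simp: coloured_systems_def PiE_def)
    then show ?thesis
      using assms(5,6) Pair
      by (simp add: f_def sentence_def type_code_less_Lambda[OF _ _ assms(4) h(1)])
  qed
  moreover have "(x, y) \<in> sim \<M> C" if "x \<in> S" "y \<in> S" "f x = f y" for x y
  proof (cases x; cases y)
    fix U\<^sub>1 c\<^sub>1 U\<^sub>2 c\<^sub>2
    assume xy: "x = (U\<^sub>1, c\<^sub>1)" "y = (U\<^sub>2, c\<^sub>2)"
    show ?thesis
      unfolding xy assms(8)
    \<comment> \<open>The complement stays in place, and equality of types alone yields the
      relation.\<close>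
    proof (intro simI cong[where g = id])
      show "finite V" if "(V, d) \<in> coloured_complements C"
        for V and d :: "'a set \<times> 'c \<Rightarrow> nat"
        using that by (simp add: coloured_complements_def)
    qed (use that xy assms(11) in \<open>auto simp: f_def\<close>)
  qed
  ultimately show ?thesis using card_quotient_le by blast
qed

end
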